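(* If $f : \mathbb{R}^n \rightarrow \mathbb{R}$ is $C^2$, then for (Lebesgue) almost all $l \in \mathbb{R}^n$, the function $f_l(x) = f(x) + l^T x$ satisfies the strict saddle property.
   Context: For a $C^2$ function $h:\mathbb{R}^n\to\mathbb{R}$, a critical point is a point $x^*$ with $\nabla h(x^* )=0$. A critical point $x^*$ is a saddle point if for every neighborhood $U$ of $x^*$ there exist $y,z\in U$ with $h(y)<h(x^* )<h(z)$. A critical point $x^*$ is a strict saddle if $\lambda_{\min}(\nabla^2 h(x^* ))<0$, where $\lambda_{\min}$ denotes the minimum eigenvalue. The function $h$ satisfies the strict saddle property (SSP) if every saddle point of $h$ is a strict saddle. "Almost all $l$" means all $l$ outside a set of Lebesgue measure zero in $\mathbb{R}^n$. *)

theory Defs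
  imports "HOL-Analysis.Analysis"
begin

definition gradient :: "(real ^ 'n \<Rightarrow> real) \<Rightarrow> real ^ 'n \<Rightarrow> real ^ 'n" where
  "gradient h x = (\<chi> i. frechet_derivative h (at x) (axis i 1))"

definition hessian :: "(real ^ 'n \<Rightarrow> real) \<Rightarrow> real ^ 'n \<Rightarrow> real ^ 'n ^ 'n" where
  "hessian h x = jacobian (gradient h) (at x)"

text \<open>Continuity of \<open>gradient h\<close> follows from its differentiability.\<close>

definition C2 :: "(real ^ 'n \<Rightarrow> real) \<Rightarrow> bool" where
  "C2 h \<longleftrightarrow>
     (\<forall>x. h differentiable (at x)) \<and>
     (\<forall>x. gradient h differentiable (at x)) \<and>
     continuous_on UNIV (hessian h)"

definition eigenvalues :: "real ^ 'n ^ 'n \<Rightarrow> real set" where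
  "eigenvalues A = {k. \<exists>v. v \<noteq> 0 \<and> A *v v = k *\<^sub>R v}"

text \<open>\<^const>\<open>Min\<close> is unspecified on empty or infinite sets; the real spectrum of a symmetric
  matrix, in particular of the Hessian of a \<open>C2\<close> function, is finite and nonempty.\<close>

definition min_eigenvalue :: "real ^ 'n ^ 'n \<Rightarrow> real" where
  "min_eigenvalue A = Min (eigenvalues A)"

definition critical_point :: "(real ^ 'n \<Rightarrow> real) \<Rightarrow> real ^ 'n \<Rightarrow> bool" where
  "critical_point h x \<longleftrightarrow> gradient h x = 0"

definition saddle_point :: "(real ^ 'n \<Rightarrow> real) \<Rightarrow> real ^ 'n \<Rightarrow> bool" where
  "saddle_point h x \<longleftrightarrow>
     critical_point h x \<and>
     (\<forall>U. open U \<and> x \<in> U \<longrightarrow> (\<exists>y\<in>U. \<exists>z\<in>U. h y < h x \<and> h x < h z))"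

definition strict_saddle :: "(real ^ 'n \<Rightarrow> real) \<Rightarrow> real ^ 'n \<Rightarrow> bool" where
  "strict_saddle h x \<longleftrightarrow> critical_point h x \<and> min_eigenvalue (hessian h x) < 0"

definition strict_saddle_property :: "(real ^ 'n \<Rightarrow> real) \<Rightarrow> bool" where
  "strict_saddle_property h \<longleftrightarrow> (\<forall>x. saddle_point h x \<longrightarrow> strict_saddle h x)"

end

theory Submission
  imports Defs
begin

text \<open>
  Every critical point of \<open>f + l \<bullet> x\<close> satisfies \<open>\<nabla>f = - l\<close>, so by Sard's theorem for \<open>\<nabla>f\<close>, for almost
  every \<open>l\<close> all critical points have a nonsingular Hessian. The Hessian is symmetric, so its smallest
  eigenvalue is then either negative or positive; in the latter case the critical point is
  a strict local minimum, hence not a saddle.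
\<close>

section \<open>Sard's theorem over an arbitrary finite index type\<close>

text \<open>
  The library's \<open>baby_Sard\<close> needs a well-ordered index type. This copy of a finite type carries
  a well-order, pulled back along an arbitrary enumeration.
\<close>

typedef 'a ordered_copy = "UNIV :: 'a set"
  by simp

instance ordered_copy :: (finite) finite
proof
  have "surj (Abs_ordered_copy :: 'a \<Rightarrow> _)"
    by (metis Rep_ordered_copy_inverse surjI)
  then show "finite (UNIV :: 'a ordered_copy set)"
    by (metis finite finite_imageI)
qed

instantiation ordered_copy :: (finite) wellorder
begin

definition less_eq_ordered_copy :: "'a ordered_copy \<Rightarrow> 'a ordered_copy \<Rightarrow> bool" where
  "x \<le> y \<longleftrightarrow> to_nat (Rep_ordered_copy x) \<le> to_nat (Rep_ordered_copy y)"

definition less_ordered_copy :: "'a ordered_copy \<Rightarrow> 'a ordered_copy \<Rightarrow> bool" where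
  "x < y \<longleftrightarrow> to_nat (Rep_ordered_copy x) < to_nat (Rep_ordered_copy y)"

instance
proof
  fix P :: "'a ordered_copy \<Rightarrow> bool" and a
  assume step: "\<And>x. (\<And>y. y < x \<Longrightarrow> P y) \<Longrightarrow> P x"
  show "P a"
    by (induction a rule: measure_induct_rule [where f = "\<lambda>x. to_nat (Rep_ordered_copy x)"])
      (use step in \<open>auto simp: less_ordered_copy_def\<close>)
qed (auto simp: less_eq_ordered_copy_def less_ordered_copy_def Rep_ordered_copy_inject)

end

lemma bij_Rep_ordered_copy: "bij Rep_ordered_copy"
  by (metis Abs_ordered_copy_inverse Rep_ordered_copy_inverse UNIV_I bijI')

text \<open>Relabelling coordinates along \<open>ordered_copy\<close> is a linear isomorphism, so
  \<open>baby_Sard\<close> applies to the conjugated map; noninjectivity of the derivative becomes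
  rank deficiency of its matrix.\<close>

lemma Sard_critical_values:
  fixes f :: "real ^ 'n \<Rightarrow> real ^ 'n"
  assumes der: "\<And>x. x \<in> S \<Longrightarrow> (f has_derivative f' x) (at x)"
    and sing: "\<And>x. x \<in> S \<Longrightarrow> \<not> inj (f' x)"
  shows "negligible (f ` S)"
proof -
  define T :: "real ^ 'n ordered_copy \<Rightarrow> real ^ 'n" where "T = (\<lambda>x. \<chi> i. x $ Abs_ordered_copy i)"
  define R :: "real ^ 'n \<Rightarrow> real ^ 'n ordered_copy" where "R = (\<lambda>x. \<chi> i. x $ Rep_ordered_copy i)"
  have TR: "T (R x) = x" for x
    by (simp add: T_def R_def vec_eq_iff Abs_ordered_copy_inverse)
  have RT: "R (T x) = x" for x
    by (simp add: T_def R_def vec_eq_iff Rep_ordered_copy_inverse)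
  have linT: "linear T" and linR: "linear R"
    by (auto intro!: linearI simp: T_def R_def vec_eq_iff)
  then have blT: "bounded_linear T" and blR: "bounded_linear R"
    by (simp_all add: linear_linear)
  have "negligible ((R \<circ> f \<circ> T) ` (R ` S))"
  proof (rule baby_Sard)
    fix y assume "y \<in> R ` S"
    then have y: "T y \<in> S"
      by (auto simp: TR)
    have "((\<lambda>y. f (T y)) has_derivative (\<lambda>v. f' (T y) (T v))) (at y)"
      using has_derivative_compose [OF bounded_linear_imp_has_derivative [OF blT] der [OF y]] .
    then have d: "((\<lambda>y. R (f (T y))) has_derivative (\<lambda>v. R (f' (T y) (T v)))) (at y)"
      by (rule bounded_linear.has_derivative [OF blR])
    then show "(R \<circ> f \<circ> T has_derivative R \<circ> f' (T y) \<circ> T) (at y within R ` S)"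
      by (simp add: o_def has_derivative_at_withinI)
    have "linear (R \<circ> f' (T y) \<circ> T)"
      using has_derivative_linear [OF d] by (simp add: o_def)
    moreover have "\<not> inj (R \<circ> f' (T y) \<circ> T)"
    proof
      assume inj: "inj (R \<circ> f' (T y) \<circ> T)"
      have "inj (f' (T y))"
      proof (rule injI)
        fix a b assume "f' (T y) a = f' (T y) b"
        then have "(R \<circ> f' (T y) \<circ> T) (R a) = (R \<circ> f' (T y) \<circ> T) (R b)"
          by (simp add: TR)
        then have "R a = R b"
          using inj by (blast dest: injD)
        then show "a = b"
          by (metis TR)
      qed
      then show False
        using sing [OF y] by blast
    qed
    ultimately show "rank (matrix (R \<circ> f' (T y) \<circ> T)) < CARD('n ordered_copy)"
      by (subst less_rank_noninjective) (simp add: matrix_vector_mul)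
  qed simp
  then have "negligible (T ` ((R \<circ> f \<circ> T) ` (R ` S)))"
  proof (rule negligible_differentiable_image_negligible [rotated])
    show "DIM(real ^ 'n ordered_copy) \<le> DIM(real ^ 'n)"
      using bij_betw_same_card [OF bij_Rep_ordered_copy [where 'a = 'n]] by simp
    show "T differentiable_on (R \<circ> f \<circ> T) ` R ` S"
      by (simp add: linT linear_imp_differentiable_on)
  qed
  then show ?thesis
    by (simp add: image_comp o_def TR)
qed

section \<open>Spectra of symmetric matrices\<close>

text \<open>The quadratic form attains its minimum \<mu> on the compact unit sphere, scaling extends
  the bound to all vectors, and the vanishing first variation at the minimiser is the eigenvector
  equation. Symmetry is stated as a bilinear identity, the form in which the second derivative
  supplies it.\<close>

lemma symmetric_min_eigenvector:
  fixes A :: "real ^ 'n ^ 'n"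
  assumes sym: "\<And>u v. u \<bullet> (A *v v) = v \<bullet> (A *v u)"
  obtains \<mu> where "\<mu> \<in> eigenvalues A" "\<And>v. \<mu> * (v \<bullet> v) \<le> v \<bullet> (A *v v)"
proof -
  have "\<exists>v\<in>sphere 0 1. \<forall>w\<in>sphere (0 :: real ^ 'n) 1. v \<bullet> (A *v v) \<le> w \<bullet> (A *v w)"
    by (intro continuous_attains_inf continuous_intros compact_sphere matrix_vector_mult_linear_continuous_on)
       auto
  then obtain v where v: "norm v = 1" and min: "\<And>w. norm w = 1 \<Longrightarrow> v \<bullet> (A *v v) \<le> w \<bullet> (A *v w)"
    by auto
  define \<mu> where "\<mu> = v \<bullet> (A *v v)"
  \<comment> \<open>The residual of the eigenvector equation. Moving from \<open>v\<close> in this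
    direction would violate the lower bound unless \<open>w = 0\<close>.\<close>
  define w where "w = A *v v - \<mu> *\<^sub>R v"
  have low: "\<mu> * (u \<bullet> u) \<le> u \<bullet> (A *v u)" for u
  proof (cases "u = 0")
    case False
    have "\<mu> \<le> (u /\<^sub>R norm u) \<bullet> (A *v (u /\<^sub>R norm u))"
      unfolding \<mu>_def by (rule min) (simp add: False)
    also have "\<dots> = (u \<bullet> (A *v u)) / (norm u)\<^sup>2"
      by (simp add: matrix_vector_mult_scaleR power2_eq_square divide_simps)
    finally show ?thesis
      using False by (simp add: field_simps power2_norm_eq_inner)
  qed simp
  \<comment> \<open>\<open>2 * a\<close> and \<open>b\<close> are the linear and quadratic
    coefficients in \<open>t\<close> of the form minus \<mu> times the squared norm at
    \<open>v + t *\<^sub>R w\<close>; the constant term vanishes by the choice of \<mu>.\<close>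
  define a where "a = w \<bullet> w"
  define b where "b = w \<bullet> (A *v w) - \<mu> * (w \<bullet> w)"
  have b: "b \<ge> 0"
    using low [of w] by (simp add: b_def)
  have vv: "v \<bullet> v = 1"
    using v by (simp add: norm_eq_1)
  have quad: "2 * t * a + t\<^sup>2 * b \<ge> 0" for t
  proof -
    have "(v + t *\<^sub>R w) \<bullet> (A *v (v + t *\<^sub>R w)) - \<mu> * ((v + t *\<^sub>R w) \<bullet> (v + t *\<^sub>R w))
        = 2 * t * (w \<bullet> (A *v v) - \<mu> * (w \<bullet> v)) + t\<^sup>2 * b"
      using sym [of v w] vv
      by (simp add: b_def \<mu>_def matrix_vector_right_distrib matrix_vector_mult_scaleR inner_add_left
          inner_add_right inner_commute [of v w] power2_eq_square algebra_simps)
    also have "w \<bullet> (A *v v) - \<mu> * (w \<bullet> v) = a"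
      by (simp add: a_def w_def [abs_def] inner_diff_right)
    finally show ?thesis
      using low [of "v + t *\<^sub>R w"] by simp
  qed
  have "a = 0"
  proof (rule ccontr)
    assume "a \<noteq> 0"
    then have a: "a > 0"
      by (simp add: a_def)
    \<comment> \<open>A negative \<open>t\<close> small enough for the linear term to dominate;
      dividing by \<open>b + 1\<close> also covers \<open>b = 0\<close>.\<close>
    have "2 * (- a / (b + 1)) * a + (- a / (b + 1))\<^sup>2 * b = - (a\<^sup>2 * (b + 2)) / (b + 1)\<^sup>2"
      using b by (simp add: divide_simps power2_eq_square) (simp add: algebra_simps)
    also have "\<dots> < 0"
      using a b by (simp add: divide_neg_pos)
    finally show False
      using quad [of "- a / (b + 1)"] by linarith
  qed
  then have "A *v v = \<mu> *\<^sub>R v"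
    by (simp add: a_def w_def)
  moreover have "v \<noteq> 0"
    using v by auto
  ultimately have "\<mu> \<in> eigenvalues A"
    by (auto simp: eigenvalues_def)
  then show ?thesis
    using low that by blast
qed

text \<open>Eigenvectors of distinct eigenvalues are orthogonal, hence independent, and the
  dimension bounds their number. Finiteness is what makes \<open>Min\<close> in
  \<open>min_eigenvalue\<close> a genuine lower bound of the spectrum.\<close>

lemma finite_eigenvalues_symmetric:
  fixes A :: "real ^ 'n ^ 'n"
  assumes sym: "\<And>u v. u \<bullet> (A *v v) = v \<bullet> (A *v u)"
  shows "finite (eigenvalues A)"
proof -
  have "\<forall>k\<in>eigenvalues A. \<exists>v. v \<noteq> 0 \<and> A *v v = k *\<^sub>R v"
    by (auto simp: eigenvalues_def)
  then obtain e where e: "\<And>k. k \<in> eigenvalues A \<Longrightarrow> e k \<noteq> 0 \<and> A *v e k = k *\<^sub>R e k"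
    by metis
  have orth: "orthogonal (e j) (e k)" if "j \<in> eigenvalues A" "k \<in> eigenvalues A" "j \<noteq> k" for j k
  proof -
    have "k * (e j \<bullet> e k) = j * (e j \<bullet> e k)"
      using sym [of "e j" "e k"] e that by (simp add: inner_commute)
    then show ?thesis
      using that by (simp add: orthogonal_def)
  qed
  have "inj_on e (eigenvalues A)"
    using orth e by (metis inj_onI orthogonal_self)
  moreover have "independent (e ` eigenvalues A)"
    using orth e by (intro pairwise_orthogonal_independent) (auto simp: pairwise_def)
  then have "finite (e ` eigenvalues A)"
    using independent_bound_general by blast
  ultimately show ?thesis
    using finite_imageD by blast
qed

section \<open>Second-order calculus\<close>

text \<open>The mean value theorem in direction \<open>u\<close> turns the second difference into an
  increment of \<open>g\<close>, which the linearisation of \<open>g\<close> at the single point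
  \<open>x\<close> controls.\<close>

lemma second_difference_approx:
  fixes h :: "'a::real_inner \<Rightarrow> real"
  assumes dh: "\<And>y. (h has_derivative (\<lambda>v. g y \<bullet> v)) (at y)"
    and dg: "(g has_derivative H) (at x)"
    and e: "e > 0"
  shows "\<exists>d>0. \<forall>t. 0 < t \<and> t < d \<longrightarrow>
    \<bar>(h (x + t *\<^sub>R u + t *\<^sub>R v) - h (x + t *\<^sub>R u) - h (x + t *\<^sub>R v) + h x) - t\<^sup>2 * (H v \<bullet> u)\<bar> \<le> e * t\<^sup>2"
proof -
  \<comment> \<open>All points at which \<open>g\<close> is evaluated lie within
    \<open>t * M\<close> of \<open>x\<close>; the summand 1 keeps \<open>M\<close> positive when
    \<open>u = v = 0\<close>. The choice of \<open>e'\<close> makes two linearisation errors, paired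
    with \<open>u\<close>, add up to \<open>e * t\<close>.\<close>
  define M where "M = norm u + norm v + 1"
  define e' where "e' = e / (2 * M\<^sup>2)"
  have M: "M > 0" "norm u \<le> M"
    by (auto simp: M_def add_nonneg_pos)
  have e': "e' > 0"
    using e M by (simp add: e'_def)
  interpret H: bounded_linear H
    using dg by (rule has_derivative_bounded_linear)
  obtain d where d: "d > 0" and
    approx: "\<And>y. norm (y - x) < d \<Longrightarrow> norm (g y - g x - H (y - x)) \<le> e' * norm (y - x)"
    using dg e' unfolding has_derivative_at_alt by blast
  show ?thesis
  proof (intro exI [of _ "d / M"] conjI allI impI)
    show "d / M > 0"
      using d M by simp
    fix t assume t: "0 < t \<and> t < d / M"
    then have tM: "t * M < d"
      using M by (simp add: field_simps)
    have err: "norm (g (x + w) - g x - H w) \<le> e' * (t * M)" if "norm w \<le> t * M" for w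
    proof -
      have "norm (g (x + w) - g x - H w) \<le> e' * norm w"
        using approx [of "x + w"] that tM by simp
      also have "\<dots> \<le> e' * (t * M)"
        using that e' by simp
      finally show ?thesis .
    qed
    \<comment> \<open>\<open>p t - p 0\<close> is the second difference, and \<open>q\<close> is the
      derivative of \<open>p\<close>.\<close>
    define p where "p = (\<lambda>s. h (x + s *\<^sub>R u + t *\<^sub>R v) - h (x + s *\<^sub>R u))"
    define q where "q = (\<lambda>s. (g (x + s *\<^sub>R u + t *\<^sub>R v) - g (x + s *\<^sub>R u)) \<bullet> u)"
    have dp: "(p has_derivative (\<lambda>r. r * q s)) (at s within {0..t})" for s
    proof -
      have "((\<lambda>s. h (x + s *\<^sub>R u + w)) has_derivative (\<lambda>r. g (x + s *\<^sub>R u + w) \<bullet> (r *\<^sub>R u))) (at s within {0..t})" for w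
        by (rule has_derivative_compose [OF _ dh]) (auto intro!: derivative_eq_intros)
      from has_derivative_diff [OF this [of "t *\<^sub>R v"] this [of 0]] show ?thesis
        by (simp add: p_def q_def inner_diff_left algebra_simps)
    qed
    obtain s where s: "0 < s" "s < t" and ps: "p t - p 0 = (t - 0) * q s"
      using mvt_simple [of 0 t p "\<lambda>s r. r * q s"] dp t by auto
    have n1: "norm (s *\<^sub>R u) \<le> t * M"
    proof -
      have "norm (s *\<^sub>R u) \<le> t * norm u"
        using s by (simp add: mult_right_mono)
      also have "\<dots> \<le> t * M"
        using t M by simp
      finally show ?thesis .
    qed
    have n2: "norm (s *\<^sub>R u + t *\<^sub>R v) \<le> t * M"
    proof -
      have "norm (s *\<^sub>R u + t *\<^sub>R v) \<le> s * norm u + t * norm v"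
        using norm_triangle_ineq [of "s *\<^sub>R u" "t *\<^sub>R v"] s t by simp
      also have "\<dots> \<le> t * norm u + t * norm v"
        using s by (simp add: mult_right_mono)
      also have "\<dots> \<le> t * M"
        using t by (simp add: M_def algebra_simps)
      finally show ?thesis .
    qed
    \<comment> \<open>The difference of the linearisation errors at
      \<open>s *\<^sub>R u + t *\<^sub>R v\<close> and \<open>s *\<^sub>R u\<close>: the unknown
      \<open>s\<close> drops out of the main term because \<open>H\<close> is linear.\<close>
    define r where "r = g (x + s *\<^sub>R u + t *\<^sub>R v) - g (x + s *\<^sub>R u) - t *\<^sub>R H v"
    have "r = (g (x + (s *\<^sub>R u + t *\<^sub>R v)) - g x - H (s *\<^sub>R u + t *\<^sub>R v)) - (g (x + s *\<^sub>R u) - g x - H (s *\<^sub>R u))"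
      by (simp add: r_def H.add H.scaleR add.assoc)
    then have "norm r \<le> e' * (t * M) + e' * (t * M)"
      using norm_triangle_ineq4 err [OF n1] err [OF n2] by (smt (verit))
    then have "\<bar>r \<bullet> u\<bar> \<le> (e' * (t * M) + e' * (t * M)) * M"
      using M e' t by (intro order_trans [OF Cauchy_Schwarz_ineq2] mult_mono) auto
    also have "\<dots> = e * t"
      using M by (simp add: e'_def power2_eq_square field_simps)
    finally have "t * \<bar>r \<bullet> u\<bar> \<le> t * (e * t)"
      using t by simp
    moreover have "q s = t * (H v \<bullet> u) + r \<bullet> u"
      by (simp add: q_def r_def inner_diff_left)
    then have "p t - p 0 - t\<^sup>2 * (H v \<bullet> u) = t * (r \<bullet> u)"
      using ps by (simp add: power2_eq_square algebra_simps)
    ultimately have "\<bar>p t - p 0 - t\<^sup>2 * (H v \<bullet> u)\<bar> \<le> e * t\<^sup>2"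
      using t by (simp add: abs_mult power2_eq_square mult_ac)
    then show "\<bar>(h (x + t *\<^sub>R u + t *\<^sub>R v) - h (x + t *\<^sub>R u) - h (x + t *\<^sub>R v) + h x) - t\<^sup>2 * (H v \<bullet> u)\<bar> \<le> e * t\<^sup>2"
      by (simp add: p_def algebra_simps)
  qed
qed

text \<open>The second difference is unchanged when \<open>u\<close> and \<open>v\<close> are
  swapped, so its two leading terms must agree.\<close>

lemma symmetric_second_derivative:
  fixes h :: "'a::real_inner \<Rightarrow> real"
  assumes dh: "\<And>y. (h has_derivative (\<lambda>v. g y \<bullet> v)) (at y)"
    and dg: "(g has_derivative H) (at x)"
  shows "u \<bullet> H v = v \<bullet> H u"
proof -
  have "\<bar>H v \<bullet> u - H u \<bullet> v\<bar> \<le> 2 * e" if e: "e > 0" for e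
  proof -
    obtain d1 where d1: "d1 > 0" "\<And>t. 0 < t \<and> t < d1 \<Longrightarrow>
      \<bar>(h (x + t *\<^sub>R u + t *\<^sub>R v) - h (x + t *\<^sub>R u) - h (x + t *\<^sub>R v) + h x) - t\<^sup>2 * (H v \<bullet> u)\<bar> \<le> e * t\<^sup>2"
      using second_difference_approx [OF dh dg e] by blast
    obtain d2 where d2: "d2 > 0" "\<And>t. 0 < t \<and> t < d2 \<Longrightarrow>
      \<bar>(h (x + t *\<^sub>R v + t *\<^sub>R u) - h (x + t *\<^sub>R v) - h (x + t *\<^sub>R u) + h x) - t\<^sup>2 * (H u \<bullet> v)\<bar> \<le> e * t\<^sup>2"
      using second_difference_approx [OF dh dg e] by blast
    define t where "t = min d1 d2 / 2"
    have t: "0 < t" "t < d1" "t < d2"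
      using d1 d2 by (auto simp: t_def)
    have "x + t *\<^sub>R v + t *\<^sub>R u = x + t *\<^sub>R u + t *\<^sub>R v"
      by simp
    with d1(2) [of t] d2(2) [of t] t have "\<bar>t\<^sup>2 * (H v \<bullet> u) - t\<^sup>2 * (H u \<bullet> v)\<bar> \<le> e * t\<^sup>2 + e * t\<^sup>2"
      by (smt (verit))
    then have "t\<^sup>2 * \<bar>H v \<bullet> u - H u \<bullet> v\<bar> \<le> t\<^sup>2 * (2 * e)"
      unfolding right_diff_distrib [symmetric] abs_mult by (simp add: mult_ac)
    then show ?thesis
      using t by (simp add: mult_le_cancel_left)
  qed
  \<comment> \<open>With \<open>e\<close> a quarter of the discrepancy, the discrepancy is at most
    half of itself, so it is zero.\<close>
  from this [of "\<bar>H v \<bullet> u - H u \<bullet> v\<bar> / 4"] show ?thesis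
    by (auto simp: inner_commute)
qed

text \<open>Near \<open>x\<close> the gradient has a nonnegative component pointing away from
  \<open>x\<close>, so the mean value theorem along the segment to \<open>y\<close> gives
  \<open>h x \<le> h y\<close>.\<close>

lemma positive_definite_imp_local_min:
  fixes h :: "'a::real_inner \<Rightarrow> real"
  assumes dh: "\<And>y. (h has_derivative (\<lambda>v. g y \<bullet> v)) (at y)"
    and dg: "(g has_derivative H) (at x)"
    and crit: "g x = 0"
    and pos: "\<mu> > 0" "\<And>v. \<mu> * (v \<bullet> v) \<le> v \<bullet> H v"
  shows "\<exists>d>0. \<forall>y\<in>ball x d. h x \<le> h y"
proof -
  \<comment> \<open>The tolerance is \<mu> itself, so the error is absorbed exactly by the lower
    bound on \<open>H\<close>.\<close>
  obtain d where d: "d > 0" and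
    approx: "\<And>y. norm (y - x) < d \<Longrightarrow> norm (g y - g x - H (y - x)) \<le> \<mu> * norm (y - x)"
    using dg pos(1) unfolding has_derivative_at_alt by blast
  have mono: "0 \<le> g (x + w) \<bullet> w" if "norm w < d" for w
  proof -
    have "\<bar>(g (x + w) - H w) \<bullet> w\<bar> \<le> (\<mu> * norm w) * norm w"
      using approx [of "x + w"] that crit
      by (intro order_trans [OF Cauchy_Schwarz_ineq2] mult_right_mono) auto
    also have "\<dots> = \<mu> * (w \<bullet> w)"
      by (simp add: norm_eq_sqrt_inner)
    also have "\<dots> \<le> H w \<bullet> w"
      using pos(2) by (simp add: inner_commute)
    finally show ?thesis
      by (simp add: inner_diff_left)
  qed
  have "h x \<le> h y" if y: "y \<in> ball x d" for y
  proof -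
    define w where "w = y - x"
    have w: "norm w < d"
      using y by (simp add: w_def dist_norm norm_minus_commute)
    have der: "((\<lambda>s. h (x + s *\<^sub>R w)) has_derivative (\<lambda>r. g (x + s *\<^sub>R w) \<bullet> (r *\<^sub>R w))) (at s within {0..1})" for s :: real
      by (rule has_derivative_compose [OF _ dh]) (auto intro!: derivative_eq_intros)
    obtain s :: real where s: "0 < s" "s < 1" and hs: "h (x + 1 *\<^sub>R w) - h (x + 0 *\<^sub>R w) = g (x + s *\<^sub>R w) \<bullet> ((1 - 0) *\<^sub>R w)"
      using mvt_simple [of 0 1 "\<lambda>s. h (x + s *\<^sub>R w)" "\<lambda>s r. g (x + s *\<^sub>R w) \<bullet> (r *\<^sub>R w)"] der by auto
    have "norm (s *\<^sub>R w) < d"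
      using s w by (smt (verit) mult_left_le_one_le norm_ge_zero norm_scaleR)
    then have "0 \<le> s * (g (x + s *\<^sub>R w) \<bullet> w)"
      using mono [of "s *\<^sub>R w"] by simp
    \<comment> \<open>The mean value point has \<open>s > 0\<close>, so the factor \<open>s\<close>
      can be cancelled without changing the sign.\<close>
    then show ?thesis
      using hs s by (simp add: w_def zero_le_mult_iff)
  qed
  then show ?thesis
    using d by blast
qed

section \<open>Gradients, nonsingular saddles and linear perturbations\<close>

lemma has_derivative_gradient:
  assumes "h differentiable (at x)"
  shows "(h has_derivative (\<lambda>v. gradient h x \<bullet> v)) (at x)"
proof -
  let ?D = "frechet_derivative h (at x)"
  have D: "(h has_derivative ?D) (at x)"
    using assms frechet_derivative_works by blast
  interpret linear ?D
    using D by (rule has_derivative_linear)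
  have "?D v = gradient h x \<bullet> v" for v
  proof -
    have "?D v = ?D (\<Sum>i\<in>UNIV. v $ i *\<^sub>R axis i 1)"
      by (simp add: basis_expansion flip: scalar_mult_eq_scaleR)
    also have "\<dots> = gradient h x \<bullet> v"
      by (simp add: sum scale gradient_def inner_vec_def mult.commute)
    finally show ?thesis .
  qed
  then show ?thesis
    using D by presburger
qed

lemma gradient_unique:
  assumes "(h has_derivative (\<lambda>v. g \<bullet> v)) (at x)"
  shows "gradient h x = g"
  using frechet_derivative_at [OF assms, symmetric]
  by (simp add: gradient_def vec_eq_iff inner_axis)

lemma gradient_add_linear:
  assumes "f differentiable (at x)"
  shows "gradient (\<lambda>x. f x + l \<bullet> x) x = gradient f x + l"
  by (rule gradient_unique)
     (auto intro!: derivative_eq_intros has_derivative_gradient assms simp: inner_add_left)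

text \<open>The number \<mu> is used in two roles: as an eigenvalue it is nonzero by injectivity,
  and as a lower bound of the quadratic form it cannot be positive, since a saddle has lower values
  arbitrarily near.\<close>

lemma nonsingular_saddle_imp_strict:
  assumes C2: "C2 h" and saddle: "saddle_point h x" and nonsing: "inj ((*v) (hessian h x))"
  shows "strict_saddle h x"
proof -
  let ?A = "hessian h x"
  have dh: "\<And>y. (h has_derivative (\<lambda>v. gradient h y \<bullet> v)) (at y)"
    using C2 by (auto simp: C2_def intro: has_derivative_gradient)
  have dg: "(gradient h has_derivative (*v) ?A) (at x)"
    using C2 by (simp add: C2_def hessian_def flip: jacobian_works)
  have crit: "gradient h x = 0"
    using saddle by (simp add: saddle_point_def critical_point_def)
  note sym = symmetric_second_derivative [OF dh dg]
  obtain \<mu> where \<mu>: "\<mu> \<in> eigenvalues ?A" and low: "\<And>v. \<mu> * (v \<bullet> v) \<le> v \<bullet> (?A *v v)"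
    using symmetric_min_eigenvector [OF sym] by blast
  have "\<mu> \<noteq> 0"
  proof
    assume "\<mu> = 0"
    then obtain v where "v \<noteq> 0" "?A *v v = ?A *v 0"
      using \<mu> by (auto simp: eigenvalues_def)
    then show False
      using nonsing by (blast dest: injD)
  qed
  moreover have "\<not> \<mu> > 0"
  proof
    assume "\<mu> > 0"
    then obtain d where "d > 0" "\<forall>y\<in>ball x d. h x \<le> h y"
      using positive_definite_imp_local_min [OF dh dg crit _ low] by blast
    moreover have "\<exists>y\<in>ball x d. h y < h x" if "d > 0"
      using saddle that unfolding saddle_point_def by (meson open_ball centre_in_ball)
    ultimately show False
      by (meson not_less)
  qed
  ultimately have "\<mu> < 0"
    by simp
  moreover have "min_eigenvalue ?A \<le> \<mu>"
    unfolding min_eigenvalue_def using finite_eigenvalues_symmetric [OF sym] \<mu> by (rule Min_le)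
  ultimately show ?thesis
    using crit by (simp add: strict_saddle_def critical_point_def)
qed

theorem corollary2p8:
  fixes f :: "real ^ 'n \<Rightarrow> real"
  assumes "C2 f"
  shows "AE l in lebesgue. strict_saddle_property (\<lambda>x. f x + l \<bullet> x)"
proof -
  define S where "S = {x. \<not> inj ((*v) (hessian f x))}"
  have df: "\<And>x. f differentiable (at x)" and dg: "\<And>x. gradient f differentiable (at x)"
    and cont: "continuous_on UNIV (hessian f)"
    using assms by (auto simp: C2_def)
  \<comment> \<open>The sign makes the critical values of this map the exceptional \<open>l\<close>
    themselves: \<open>x\<close> is critical for the perturbed function exactly when
    \<open>l = - gradient f x\<close>.\<close>
  have "((\<lambda>x. - gradient f x) has_derivative (\<lambda>v. - (hessian f x *v v))) (at x)" for x
    using dg by (auto intro!: derivative_eq_intros simp: hessian_def jacobian_works [symmetric])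
  moreover have "\<not> inj (\<lambda>v. - (hessian f x *v v))" if "x \<in> S" for x
    using that by (auto simp: S_def inj_def)
  ultimately have "negligible ((\<lambda>x. - gradient f x) ` S)"
    by (rule Sard_critical_values)
  then have null: "(\<lambda>x. - gradient f x) ` S \<in> null_sets lebesgue"
    by (simp add: negligible_iff_null_sets)
  show ?thesis
  proof (rule AE_I' [OF null], clarify, rule ccontr)
    fix l
    assume not_ssp: "\<not> strict_saddle_property (\<lambda>x. f x + l \<bullet> x)" and l: "l \<notin> (\<lambda>x. - gradient f x) ` S"
    let ?h = "\<lambda>x. f x + l \<bullet> x"
    have grad: "gradient ?h = (\<lambda>x. gradient f x + l)"
      using gradient_add_linear df by blast
    \<comment> \<open>The linear term only shifts the gradient by a constant, so one set
      \<open>S\<close> serves every \<open>l\<close>.\<close>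
    have jac: "hessian ?h x = hessian f x" for x
    proof -
      have "(gradient ?h has_derivative (*v) (hessian f x)) (at x)"
        unfolding grad using dg by (auto intro!: derivative_eq_intros simp: hessian_def jacobian_works [symmetric])
      then show ?thesis
        by (metis frechet_derivative_at hessian_def jacobian_def matrix_of_matrix_vector_mul)
    qed
    have C2h: "C2 ?h"
      unfolding C2_def
    proof (intro conjI allI)
      show "?h differentiable at x" for x
        using df by (intro differentiable_add) (auto intro!: derivative_intros simp: differentiable_def)
      show "gradient ?h differentiable at x" for x
        unfolding grad using dg by (intro differentiable_add) auto
      show "continuous_on UNIV (hessian ?h)"
        using cont jac by presburger
    qed
    have "strict_saddle ?h x" if sad: "saddle_point ?h x" for x
    proof (rule nonsingular_saddle_imp_strict [OF C2h sad])
      \<comment> \<open>If the Hessian were singular at \<open>x\<close>, then \<open>x\<close>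
        would lie in \<open>S\<close> and \<open>l\<close> in the excluded null set.\<close>
      have "l = - gradient f x"
        using sad by (simp add: saddle_point_def critical_point_def grad add_eq_0_iff)
      then show "inj ((*v) (hessian ?h x))"
        using l unfolding S_def jac by blast
    qed
    then show False
      using not_ssp by (simp add: strict_saddle_property_def)
  qed
qed

end
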